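(* Let $\alpha>0$ and $0<\gamma<1$, and let $\mathcal{F}$ be any one of the families $\mathcal{IF}$, $\mathcal{AP}$, $\mathcal{PS}$, $\mathcal{HSD}$, $\mathcal{J}$, $\mathcal{PUAD}$, $\mathcal{PUBD}$ of subsets of $\mathbb{N}$. If $A$ is an essential $\mathcal{F}^{\star}$-set in $\mathbb{N}$, then $g_{\alpha,\gamma}[A]$ is an essential $\mathcal{F}^{\star}$-set in $\mathbb{N}$.
   Context: $\mathbb{N}=\{1,2,3,\dots\}$; $\mathcal{P}_f(X)$ is the set of finite nonempty subsets of $X$. For $\alpha>0$ and $0<\gamma<1$, $g_{\alpha,\gamma}(n)=\lfloor \alpha n+\gamma\rfloor$ for $n\in\mathbb{N}$; for $A\subseteq\mathbb{N}$, $g_{\alpha,\gamma}[A]=\{g_{\alpha,\gamma}(n):n\in A\}\cap\mathbb{N}$ (a value $0$, which can occur for finitely many $n$ when $\alpha$ is small, is discarded). Families of subsets $A$ of $\mathbb{N}$: - $\mathcal{IF}$: infinite sets. - $\mathcal{AP}$: sets containing arithmetic progressions (nonzero common difference) of arbitrary finite length. - $\mathcal{PS}$: piecewise syndetic sets, i.e. there is $G\in\mathcal{P}_f(\mathbb{N})$ such that for every $F\in\mathcal{P}_f(\mathbb{N})$ there is $x\in\mathbb{N}$ with $F+x\subseteq\bigcup_{t\in G}(-t+A)$, where $-t+A=\{s\in\mathbb{N}:t+s\in A\}$. - $\mathcal{HSD}$: sets with $\sum_{n\in A}\frac1n=\infty$. - $\mathcal{J}$: $J$-sets, i.e. for every finite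 nonempty set $F$ of sequences $f:\mathbb{N}\to\mathbb{N}$ there are $a\in\mathbb{N}$ and $H\in\mathcal{P}_f(\mathbb{N})$ with $a+\sum_{n\in H}f(n)\in A$ for all $f\in F$. - $\mathcal{PUAD}$: sets with $\overline{d}(A)=\limsup_{n\to\infty}\frac{|A\cap\{1,\dots,n\}|}{n}>0$. - $\mathcal{PUBD}$: sets with $d^{\star}(A)=\limsup_{n-m\to\infty}\frac{|A\cap\{m+1,\dots,n\}|}{n-m}>0$. Each of these is a nonempty upward hereditary collection of nonempty sets with the Ramsey property (if a member is a union of two sets, one of them is a member). $\beta\mathbb{N}$ is the set of ultrafilters on $\mathbb{N}$ with the operation $A\in p+q\iff\{x\in\mathbb{N}:-x+A\in q\}\in p$. Put $\beta(\mathcal{F})=\{p\in\beta\mathbb{N}:p\subseteq\mathcal{F}\}$, which is a subsemigroup of $\beta\mathbb{N}$ for each of these families. $A\subseteq\mathbb{N}$ is an essential $\mathcal{F}$-set if $A\in p$ for some idempotent $p=p+p$ in $\beta(\mathcal{F})$, and $A\subseteq\mathbb{N}$ is an essential $\mathcal{F}^{\star}$-set if $A$ has nonempty intersection with every essential $\mathcal{F}$-set. *)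

theory Defs
  imports "HOL-Analysis.Analysis"
begin

text \<open>Here 0 is not a natural number: the ground set is the following subset of the type.\<close>

abbreviation Npos :: "nat set" where
  "Npos \<equiv> {0<..}"

definition g :: "real \<Rightarrow> real \<Rightarrow> nat \<Rightarrow> nat" where
  "g \<alpha> \<gamma> n = nat \<lfloor>\<alpha> * real n + \<gamma>\<rfloor>"

definition g_image :: "real \<Rightarrow> real \<Rightarrow> nat set \<Rightarrow> nat set" where
  "g_image \<alpha> \<gamma> A = g \<alpha> \<gamma> ` A \<inter> Npos"

definition shift :: "nat \<Rightarrow> nat set \<Rightarrow> nat set" where
  "shift t A = {s \<in> Npos. t + s \<in> A}"

definition fam_IF :: "nat set set" where
  "fam_IF = {A. A \<subseteq> Npos \<and> infinite A}"

definition fam_AP :: "nat set set" where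
  "fam_AP = {A. A \<subseteq> Npos \<and>
    (\<forall>k. \<exists>a\<in>Npos. \<exists>d\<in>Npos. \<forall>i<k. a + i * d \<in> A)}"

definition fam_PS :: "nat set set" where
  "fam_PS = {A. A \<subseteq> Npos \<and>
    (\<exists>G. finite G \<and> G \<noteq> {} \<and> G \<subseteq> Npos \<and>
      (\<forall>F. finite F \<and> F \<noteq> {} \<and> F \<subseteq> Npos \<longrightarrow>
        (\<exists>x\<in>Npos. (\<lambda>s. s + x) ` F \<subseteq> (\<Union>t\<in>G. shift t A))))}"

text \<open>The terms are nonnegative, so divergence to infinity is failure of summability.\<close>

definition fam_HSD :: "nat set set" where
  "fam_HSD = {A. A \<subseteq> Npos \<and> \<not> (\<lambda>n. 1 / real n) summable_on A}"

text \<open>A sequence is represented by a function on the whole type; its value at 0 is never used.\<close>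

definition fam_J :: "nat set set" where
  "fam_J = {A. A \<subseteq> Npos \<and>
    (\<forall>F. finite F \<and> F \<noteq> {} \<and> F \<subseteq> (Npos \<rightarrow> Npos) \<longrightarrow>
      (\<exists>a\<in>Npos. \<exists>H. finite H \<and> H \<noteq> {} \<and> H \<subseteq> Npos \<and>
        (\<forall>f\<in>F. a + (\<Sum>n\<in>H. f n) \<in> A)))}"

definition upper_density :: "nat set \<Rightarrow> ereal" where
  "upper_density A = limsup (\<lambda>n. ereal (real (card (A \<inter> {1..n})) / real n))"

text \<open>The limit superior is taken along the filter of pairs \<open>(m, n)\<close> with \<open>n - m \<rightarrow> \<infinity>\<close>.
  Truncated subtraction is harmless: a large value of \<open>n - m\<close> forces \<open>m < n\<close>.
  Including the pairs with \<open>m = 0\<close> does not change the value.\<close>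

definition upper_banach_density :: "nat set \<Rightarrow> ereal" where
  "upper_banach_density A =
    Limsup (filtercomap (\<lambda>(m, n). n - m) at_top)
      (\<lambda>(m, n). ereal (real (card (A \<inter> {m + 1..n})) / real (n - m)))"

definition fam_PUAD :: "nat set set" where
  "fam_PUAD = {A. A \<subseteq> Npos \<and> upper_density A > 0}"

definition fam_PUBD :: "nat set set" where
  "fam_PUBD = {A. A \<subseteq> Npos \<and> upper_banach_density A > 0}"

definition ultrafilters_N :: "nat set set set" where
  "ultrafilters_N = {p. p \<subseteq> Pow Npos \<and> Npos \<in> p \<and> {} \<notin> p \<and>
    (\<forall>A B. A \<in> p \<and> B \<in> p \<longrightarrow> A \<inter> B \<in> p) \<and>
    (\<forall>A B. A \<in> p \<and> A \<subseteq> B \<and> B \<subseteq> Npos \<longrightarrow> B \<in> p) \<and>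
    (\<forall>A. A \<subseteq> Npos \<longrightarrow> A \<in> p \<or> Npos - A \<in> p)}"

definition uf_plus :: "nat set set \<Rightarrow> nat set set \<Rightarrow> nat set set" where
  "uf_plus p q = {A. A \<subseteq> Npos \<and> {x \<in> Npos. shift x A \<in> q} \<in> p}"

definition beta :: "nat set set \<Rightarrow> nat set set set" where
  "beta \<F> = {p \<in> ultrafilters_N. p \<subseteq> \<F>}"

definition essential :: "nat set set \<Rightarrow> nat set \<Rightarrow> bool" where
  "essential \<F> A \<longleftrightarrow> A \<subseteq> Npos \<and> (\<exists>p \<in> beta \<F>. uf_plus p p = p \<and> A \<in> p)"

definition essential_star :: "nat set set \<Rightarrow> nat set \<Rightarrow> bool" where
  "essential_star \<F> A \<longleftrightarrow> A \<subseteq> Npos \<and> (\<forall>B. essential \<F> B \<longrightarrow> A \<inter> B \<noteq> {})"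

end

theory Submission imports Defs begin

text \<open>
  Being an essential star set means belonging to every idempotent ultrafilter contained in the
  family. So, given an essential set \<open>B\<close> with idempotent \<open>q\<close>, it suffices to find an idempotent
  \<open>p\<close> in the family whose image under \<open>g \<alpha> \<gamma>\<close> is \<open>q\<close>: then \<open>A\<close> lies in \<open>p\<close>, and its image meets
  \<open>B\<close>. The ultrafilter \<open>p\<close> is the image of \<open>q\<close> under an approximate inverse of \<open>g \<alpha> \<gamma>\<close>,
  namely \<open>h = g (1/\<alpha>) (1/2)\<close>, which rounds \<open>n/\<alpha>\<close> to the nearest integer.

  What makes \<open>h\<close> behave well is that \<open>n \<mapsto> n/\<alpha>\<close> is a homomorphism to the circle, so the limit of
  \<open>n/\<alpha>\<close> modulo 1 along an idempotent is an idempotent of the circle group, that is, 0. Hence \<open>q\<close>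
  contains every Bohr set of those \<open>n\<close> for which \<open>n/\<alpha>\<close> is within \<open>\<epsilon>\<close> of a positive integer
  (\<open>idempotent_bohr\<close>). On a Bohr set \<open>h\<close> is additive, so \<open>p\<close> is again idempotent
  (\<open>uf_image_idempotent\<close>); and since \<open>\<gamma>\<close> is neither 0 nor 1, the small rounding error is absorbed
  and \<open>g \<alpha> \<gamma> (h n) = n\<close> there (\<open>g_inverse_on_bohr\<close>).

  It remains to see that \<open>p\<close> stays in the family: the image under \<open>h\<close> of a member of the family
  contained in a Bohr set is again a member. For most families this only uses that \<open>h\<close> is injective
  on the set and at bounded distance from a linear function. For arithmetic progressions
  one also needs that \<open>h\<close> has constant increments along a progression inside a Bohr set. The
  substantial case is that of J-sets (\<open>fam_J_image\<close>): there the given sequences are summed over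
  disjoint blocks on which \<open>\<alpha>\<close> times each block sum is extremely close to an integer, so that the
  J-property can be applied to these integers and the solution carried back by \<open>h\<close>.
\<close>

section \<open>Rounding and Bohr sets\<close>

text \<open>Positivity of the rounded value is part of the definition so that rounding maps a Bohr set into
  the ground set.\<close>

definition bohr :: "real \<Rightarrow> real \<Rightarrow> nat set" where
  "bohr \<beta> \<epsilon> = {n. 0 < n \<and> 0 < g \<beta> (1/2) n \<and> \<bar>\<beta> * real n - real (g \<beta> (1/2) n)\<bar> < \<epsilon>}"

lemma real_g_half:
  assumes "0 \<le> \<beta>"
  shows "real (g \<beta> (1/2) n) = of_int (round (\<beta> * real n))"
  using assms by (simp add: g_def round_def)

lemma g_half_error:
  assumes "0 \<le> \<beta>"
  shows "\<bar>\<beta> * real n - real (g \<beta> (1/2) n)\<bar> \<le> 1/2"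
  using of_int_round_abs_le[of "\<beta> * real n"] real_g_half[OF assms, of n] by (simp add: abs_minus_commute)

lemma g_half_nearest:
  assumes "0 \<le> \<beta>"
  shows "\<bar>\<beta> * real n - real (g \<beta> (1/2) n)\<bar> \<le> \<bar>\<beta> * real n - of_int k\<bar>"
  using round_diff_minimal[of "\<beta> * real n" k] real_g_half[OF assms] by simp

lemma g_half_mono:
  assumes "0 \<le> \<beta>" "m \<le> n"
  shows "g \<beta> (1/2) m \<le> g \<beta> (1/2) n"
  unfolding g_def using assms by (intro nat_mono floor_mono add_right_mono mult_left_mono) auto

lemma g_half_le_mult:
  assumes "0 \<le> \<beta>" "\<beta> + 1 \<le> real K" "0 < n"
  shows "g \<beta> (1/2) n \<le> K * n"
proof -
  have "real (g \<beta> (1/2) n) \<le> \<beta> * real n + 1/2"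
    using g_half_error[OF assms(1), of n] by linarith
  also have "\<dots> \<le> (\<beta> + 1) * real n"
    using assms by (simp add: algebra_simps)
  also have "\<dots> \<le> real K * real n"
    using assms by (intro mult_right_mono) auto
  finally show ?thesis
    by (metis of_nat_le_iff of_nat_mult)
qed

text \<open>The three rounding errors are below 1/4, below 1/4 and at most 1/2, so the two integers compared
  differ by less than 1.\<close>

lemma g_half_add:
  assumes "x \<in> bohr \<beta> (1/4)" "y \<in> bohr \<beta> (1/4)" "0 \<le> \<beta>"
  shows "g \<beta> (1/2) (x + y) = g \<beta> (1/2) x + g \<beta> (1/2) y"
proof -
  let ?h = "g \<beta> (1/2)"
  have "\<bar>real (?h (x + y)) - real (?h x + ?h y)\<bar> < 1"
    using assms g_half_error[OF assms(3), of "x + y"]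
    by (auto simp: bohr_def distrib_left abs_if split: if_splits)
  then show ?thesis by linarith
qed

lemma frac_cell_range: "\<lfloor>real (Suc M) * frac x\<rfloor> \<in> {0..int (Suc M)}"
proof -
  have "real (Suc M) * frac x \<le> real (Suc M) * 1"
    by (intro mult_left_mono less_imp_le[OF frac_lt_1]) auto
  then have "\<lfloor>real (Suc M) * frac x\<rfloor> \<le> \<lfloor>of_int (int (Suc M)) :: real\<rfloor>"
    by (intro floor_mono) simp
  moreover have "0 \<le> \<lfloor>real (Suc M) * frac x\<rfloor>" by simp
  ultimately show ?thesis by (simp only: floor_of_int atLeastAtMost_iff)
qed

text \<open>Together with the finiteness of the set of cells, this is the compactness of the circle in the
  form needed for pigeonhole arguments.\<close>

lemma frac_cell_close:
  assumes "\<lfloor>real (Suc M) * frac x\<rfloor> = \<lfloor>real (Suc M) * frac y\<rfloor>"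
  shows "\<bar>x - y - of_int (\<lfloor>x\<rfloor> - \<lfloor>y\<rfloor>)\<bar> < inverse (real (Suc M))"
proof -
  have "\<bar>real (Suc M) * frac x - real (Suc M) * frac y\<bar> < 1" using assms by linarith
  also have "real (Suc M) * frac x - real (Suc M) * frac y =
      real (Suc M) * (x - y - of_int (\<lfloor>x\<rfloor> - \<lfloor>y\<rfloor>))"
    by (simp add: frac_def algebra_simps)
  finally have "real (Suc M) * \<bar>x - y - of_int (\<lfloor>x\<rfloor> - \<lfloor>y\<rfloor>)\<bar> < 1"
    by (simp only: abs_mult abs_of_nat)
  then show ?thesis by (simp add: field_simps del: of_nat_Suc of_int_diff)
qed

lemma bohr_mono: "\<epsilon> \<le> \<delta> \<Longrightarrow> bohr \<beta> \<epsilon> \<subseteq> bohr \<beta> \<delta>"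
  by (auto simp: bohr_def)

text \<open>Multiplying the rounding error by \<open>\<alpha>\<close> moves \<open>n\<close> by less than the distance from \<open>\<gamma>\<close> to 0 and to
  1, so adding \<open>\<gamma>\<close> and taking the floor recovers \<open>n\<close>.\<close>

lemma g_inverse_on_bohr:
  assumes "0 < \<alpha>" "\<alpha> * \<epsilon> \<le> \<gamma>" "\<alpha> * \<epsilon> \<le> 1 - \<gamma>" "n \<in> bohr (1/\<alpha>) \<epsilon>"
  shows "g \<alpha> \<gamma> (g (1/\<alpha>) (1/2) n) = n"
proof -
  let ?m = "g (1/\<alpha>) (1/2) n"
  have "\<bar>real n / \<alpha> - real ?m\<bar> < \<epsilon>" using assms by (simp add: bohr_def)
  then have "\<alpha> * \<bar>real n / \<alpha> - real ?m\<bar> < \<alpha> * \<epsilon>" using assms by simp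
  moreover have "\<alpha> * \<bar>real n / \<alpha> - real ?m\<bar> = \<bar>real n - \<alpha> * real ?m\<bar>"
  proof -
    have "\<alpha> * \<bar>real n / \<alpha> - real ?m\<bar> = \<bar>\<alpha> * (real n / \<alpha> - real ?m)\<bar>"
      using assms(1) by (simp add: abs_mult)
    also have "\<alpha> * (real n / \<alpha> - real ?m) = real n - \<alpha> * real ?m"
      using assms(1) by (simp add: right_diff_distrib)
    finally show ?thesis .
  qed
  ultimately have "\<bar>real n - \<alpha> * real ?m\<bar> < \<alpha> * \<epsilon>" by simp
  then have "\<lfloor>\<alpha> * real ?m + \<gamma>\<rfloor> = int n"
    using assms by (intro floor_unique) auto
  then show ?thesis by (simp add: g_def[of \<alpha>])
qed

section \<open>Idempotent ultrafilters\<close>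

lemma
  assumes "q \<in> ultrafilters_N"
  shows uf_inter: "A \<in> q \<Longrightarrow> B \<in> q \<Longrightarrow> A \<inter> B \<in> q"
    and uf_up: "A \<in> q \<Longrightarrow> A \<subseteq> B \<Longrightarrow> B \<subseteq> Npos \<Longrightarrow> B \<in> q"
    and uf_nonempty: "A \<in> q \<Longrightarrow> A \<noteq> {}"
    and uf_Npos: "Npos \<in> q"
    and uf_sub: "A \<in> q \<Longrightarrow> A \<subseteq> Npos"
    and uf_compl: "A \<subseteq> Npos \<Longrightarrow> A \<in> q \<or> Npos - A \<in> q"
  using assms by (auto simp: ultrafilters_N_def)

lemma uf_colour_class:
  assumes q: "q \<in> ultrafilters_N" and "finite K"
  shows "{n \<in> Npos. c n \<in> K} \<in> q \<Longrightarrow> \<exists>k\<in>K. {n \<in> Npos. c n = k} \<in> q"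
  using \<open>finite K\<close>
proof (induction K)
  case empty
  then show ?case using uf_nonempty[OF q] by auto
next
  case (insert k K)
  let ?A = "{n \<in> Npos. c n = k}"
  show ?case
  proof (cases "?A \<in> q")
    case False
    then have "Npos - ?A \<in> q" using uf_compl[OF q, of ?A] by auto
    from uf_inter[OF q insert.prems this] have "{n \<in> Npos. c n \<in> K} \<in> q"
      by (rule uf_up[OF q]) auto
    then show ?thesis using insert.IH by auto
  qed auto
qed

text \<open>Some colour class belongs to \<open>q\<close>, and idempotency turns this into
  solutions of \<open>x + y = z\<close> within it. What matters below is that, with \<open>x\<close> fixed, \<open>y\<close> can range over
  a whole member of \<open>q\<close>.\<close>

lemma idempotent_schur:
  assumes q: "q \<in> ultrafilters_N" and idem: "uf_plus q q = q" and "finite (range c)"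
  obtains x E where "0 < x" "E \<in> q" "\<And>y. y \<in> E \<Longrightarrow> c y = c x \<and> c (x + y) = c x"
proof -
  have "{n \<in> Npos. c n \<in> range c} = Npos" by auto
  then obtain k where D: "{n \<in> Npos. c n = k} \<in> q" (is "?D \<in> q")
    using uf_colour_class[OF q assms(3)] uf_Npos[OF q] by metis
  then have "?D \<in> uf_plus q q" using idem by simp
  then have "{x \<in> Npos. shift x ?D \<in> q} \<in> q" by (simp add: uf_plus_def)
  from uf_nonempty[OF q uf_inter[OF q D this]]
  obtain x where x: "0 < x" "c x = k" "shift x ?D \<in> q" by auto
  show thesis
    by (rule that[OF x(1) uf_inter[OF q D x(3)]]) (auto simp: shift_def x)
qed

text \<open>Colour \<open>n\<close> by the cell of the circle that contains \<open>\<beta> n\<close>. If \<open>x\<close> and \<open>x + y\<close> lie in the same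
  cell, then \<open>\<beta> y = \<beta> (x + y) - \<beta> x\<close> is close to an integer, and by the preceding lemma this happens
  for all \<open>y\<close> in a member of \<open>q\<close>.\<close>

lemma idempotent_bohr:
  assumes q: "q \<in> ultrafilters_N" and idem: "uf_plus q q = q" and "0 < \<beta>" "0 < \<epsilon>"
  shows "bohr \<beta> \<epsilon> \<in> q"
proof -
  obtain M where M: "inverse (real (Suc M)) < \<epsilon>" using reals_Archimedean[OF \<open>0 < \<epsilon>\<close>] by auto
  let ?c = "\<lambda>n. \<lfloor>real (Suc M) * frac (\<beta> * real n)\<rfloor>"
  have "range ?c \<subseteq> {0..int (Suc M)}" using frac_cell_range by auto
  then have fin: "finite (range ?c)" by (rule finite_subset) simp
  obtain x E where x: "0 < x" "E \<in> q" and xE: "\<And>y. y \<in> E \<Longrightarrow> ?c y = ?c x \<and> ?c (x + y) = ?c x"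
    using idempotent_schur[OF q idem fin] by metis
  obtain N where N: "1 / \<beta> < real N" using reals_Archimedean2 by blast
  \<comment> \<open>Truncation at \<open>N\<close> as a colouring makes \<open>y\<close> large: \<open>z\<close> and \<open>z + y\<close> have the same truncation
    only if that truncation is \<open>N\<close>.\<close>
  have fin': "finite (range (\<lambda>n. min n N))"
    by (rule finite_subset[of _ "{..N}"]) auto
  obtain z E' where z: "0 < z" "E' \<in> q" and zE: "\<And>y. y \<in> E' \<Longrightarrow> min y N = min z N \<and> min (z + y) N = min z N"
    using idempotent_schur[OF q idem fin'] by metis
  show ?thesis
  proof (rule uf_up[OF q uf_inter[OF q x(2) z(2)]])
    show "E \<inter> E' \<subseteq> bohr \<beta> \<epsilon>"
    proof
      fix y assume y: "y \<in> E \<inter> E'"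
      have y0: "0 < y" using uf_sub[OF q x(2)] y by auto
      have "min y N = min z N" "min (z + y) N = min z N" using zE y by auto
      then have "N \<le> y" using y0 z by (auto simp: min_def split: if_splits)
      then have "1 / \<beta> < real y" using N by linarith
      then have "1 < \<beta> * real y" using \<open>0 < \<beta>\<close> by (simp add: field_simps)
      then have pos: "0 < g \<beta> (1/2) y" by (simp add: g_def)
      have "?c (x + y) = ?c x" using xE y by auto
      from frac_cell_close[OF this]
      have "\<bar>\<beta> * real y - of_int (\<lfloor>\<beta> * real (x + y)\<rfloor> - \<lfloor>\<beta> * real x\<rfloor>)\<bar> < inverse (real (Suc M))"
        by (simp add: distrib_left)
      then show "y \<in> bohr \<beta> \<epsilon>"
        using g_half_nearest[of \<beta> y "\<lfloor>\<beta> * real (x + y)\<rfloor> - \<lfloor>\<beta> * real x\<rfloor>"] pos y0 M \<open>0 < \<beta>\<close>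
        unfolding bohr_def by simp
    qed
  qed (auto simp: bohr_def)
qed

text \<open>This is the usual push-forward, except that \<open>h\<close> need not be positive everywhere: points mapped
  to 0 are ignored.\<close>

definition uf_image :: "(nat \<Rightarrow> nat) \<Rightarrow> nat set set \<Rightarrow> nat set set" where
  "uf_image h q = {D. D \<subseteq> Npos \<and> {n \<in> Npos. h n \<in> D} \<in> q}"

lemma uf_image_ultrafilter:
  assumes q: "q \<in> ultrafilters_N" and E: "E \<in> q" "\<And>x. x \<in> E \<Longrightarrow> 0 < h x"
  shows "uf_image h q \<in> ultrafilters_N"
proof -
  have 1: "{n \<in> Npos. h n \<in> Npos} \<in> q"
    by (rule uf_up[OF q E(1)]) (use E(2) uf_sub[OF q E(1)] in auto)
  have 2: "{n \<in> Npos. h n \<in> A \<and> h n \<in> B} \<in> q"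
    if "{n \<in> Npos. h n \<in> A} \<in> q" "{n \<in> Npos. h n \<in> B} \<in> q" for A B
    by (rule uf_up[OF q uf_inter[OF q that]]) auto
  have 3: "{n \<in> Npos. h n \<in> B} \<in> q" if "{n \<in> Npos. h n \<in> A} \<in> q" "A \<subseteq> B" for A B
    by (rule uf_up[OF q that(1)]) (use that in auto)
  have 4: "{n \<in> Npos. h n \<in> A} \<in> q \<or> {n \<in> Npos. h n \<in> Npos - A} \<in> q" for A
  proof -
    have "{n \<in> Npos. h n \<in> A} \<in> q \<or> Npos - {n \<in> Npos. h n \<in> A} \<in> q"
      by (rule uf_compl[OF q]) auto
    moreover have "{n \<in> Npos. h n \<in> Npos - A} \<in> q" if "Npos - {n \<in> Npos. h n \<in> A} \<in> q"
      by (rule uf_up[OF q uf_inter[OF q that 1]]) auto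
    ultimately show ?thesis by blast
  qed
  have 5: "{} \<notin> q" using uf_nonempty[OF q] by blast
  show ?thesis
    unfolding ultrafilters_N_def uf_image_def mem_Collect_eq
    using 1 2 3 4 5 by (intro conjI allI impI) auto
qed

lemma uf_cong:
  assumes q: "q \<in> ultrafilters_N" and "E \<in> q" "X \<subseteq> Npos" "Y \<subseteq> Npos"
    and "\<And>n. n \<in> E \<Longrightarrow> n \<in> X \<longleftrightarrow> n \<in> Y"
  shows "X \<in> q \<longleftrightarrow> Y \<in> q"
proof
  assume "X \<in> q"
  from uf_inter[OF q this \<open>E \<in> q\<close>] show "Y \<in> q" by (rule uf_up[OF q]) (use assms in auto)
next
  assume "Y \<in> q"
  from uf_inter[OF q this \<open>E \<in> q\<close>] show "X \<in> q" by (rule uf_up[OF q]) (use assms in auto)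
qed

text \<open>A member of \<open>q\<close> on which \<open>h\<close> is additive is enough, because the sum of ultrafilters samples both
  summands from \<open>q\<close>.\<close>

lemma uf_image_idempotent:
  assumes q: "q \<in> ultrafilters_N" and idem: "uf_plus q q = q"
    and E: "E \<in> q" "\<And>x. x \<in> E \<Longrightarrow> 0 < h x"
    and add: "\<And>x y. x \<in> E \<Longrightarrow> y \<in> E \<Longrightarrow> h (x + y) = h x + h y"
  shows "uf_plus (uf_image h q) (uf_image h q) = uf_image h q"
proof -
  have E0: "E \<subseteq> Npos" using uf_sub[OF q E(1)] .
  have "D \<in> uf_plus (uf_image h q) (uf_image h q) \<longleftrightarrow> D \<in> uf_image h q" if "D \<subseteq> Npos" for D
  proof -
    let ?D = "{n \<in> Npos. h n \<in> D}"
    have inner: "{m \<in> Npos. h m \<in> shift (h n) D} \<in> q \<longleftrightarrow> shift n ?D \<in> q" if "n \<in> E" for n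
      by (rule uf_cong[OF q E(1)]) (use that E E0 add in \<open>auto simp: shift_def\<close>)
    have sh: "shift k D \<subseteq> Npos" for k by (auto simp: shift_def)
    have "D \<in> uf_plus (uf_image h q) (uf_image h q) \<longleftrightarrow>
        {n \<in> Npos. 0 < h n \<and> {m \<in> Npos. h m \<in> shift (h n) D} \<in> q} \<in> q"
      using that sh by (auto simp: uf_plus_def uf_image_def)
    also have "\<dots> \<longleftrightarrow> {n \<in> Npos. shift n ?D \<in> q} \<in> q"
      by (rule uf_cong[OF q E(1)]) (use E inner in auto)
    also have "\<dots> \<longleftrightarrow> ?D \<in> uf_plus q q" by (auto simp: uf_plus_def)
    also have "\<dots> \<longleftrightarrow> D \<in> uf_image h q" using that by (auto simp: uf_image_def idem)
    finally show ?thesis .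
  qed
  then show ?thesis by (auto simp: uf_plus_def uf_image_def)
qed

section \<open>The families are preserved by rounding on Bohr sets\<close>

lemma fam_IF_image:
  assumes "C \<in> fam_IF" "inj_on h C" "h ` C \<subseteq> D" "D \<subseteq> Npos"
  shows "D \<in> fam_IF"
  using assms finite_imageD[of h C] finite_subset[of "h ` C" D] by (auto simp: fam_IF_def)

text \<open>Along a progression in the Bohr set, each increment of the rounded values is an integer within
  1/2 of \<open>\<beta> d\<close>, so all increments agree; injectivity makes the common increment nonzero.\<close>

lemma fam_AP_image:
  assumes C: "C \<in> fam_AP" "C \<subseteq> bohr \<beta> (1/4)" and inj: "inj_on (g \<beta> (1/2)) C" and "0 \<le> \<beta>"
    and D: "g \<beta> (1/2) ` C \<subseteq> D" "D \<subseteq> Npos"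
  shows "D \<in> fam_AP"
proof -
  let ?h = "g \<beta> (1/2)"
  have "\<exists>a\<in>Npos. \<exists>d\<in>Npos. \<forall>i<k. a + i * d \<in> D" for k
  proof -
    \<comment> \<open>Two additional terms guarantee that the progression has a first increment, even for small \<open>k\<close>.\<close>
    from C(1) obtain a d where ad: "0 < a" "0 < d" "\<And>i. i < k + 2 \<Longrightarrow> a + i * d \<in> C"
      unfolding fam_AP_def mem_Collect_eq by (metis greaterThan_iff)
    have near: "\<bar>\<beta> * real (a + i * d) - real (?h (a + i * d))\<bar> < 1/4" if "i < k + 2" for i
      using C(2) ad(3)[OF that] by (auto simp: bohr_def)
    have C01: "a \<in> C" "a + d \<in> C" using ad(3)[of 0] ad(3)[of 1] by auto
    define e where "e = ?h (a + d) - ?h a"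
    have "?h a \<noteq> ?h (a + d)" using inj C01 \<open>0 < d\<close> by (auto dest: inj_onD)
    moreover have "?h a \<le> ?h (a + d)" using \<open>0 \<le> \<beta>\<close> by (intro g_half_mono) auto
    ultimately have e: "0 < e" "?h (a + d) = ?h a + e" by (auto simp: e_def)
    have step: "?h (a + Suc i * d) = ?h (a + i * d) + e" if "Suc i < k + 2" for i
    proof -
      have "\<bar>\<beta> * real (a + i * d) - real (?h (a + i * d))\<bar> < 1/4" using that by (intro near) auto
      moreover have "\<bar>\<beta> * real (a + Suc i * d) - real (?h (a + Suc i * d))\<bar> < 1/4" using that by (intro near) auto
      moreover have "\<bar>\<beta> * real a - real (?h a)\<bar> < 1/4" using near[of 0] by simp
      moreover have "\<bar>\<beta> * real (a + d) - real (?h a + e)\<bar> < 1/4" using near[of 1] e(2) by simp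
      moreover have "\<beta> * real (a + Suc i * d) - \<beta> * real (a + i * d) = \<beta> * real (a + d) - \<beta> * real a"
        by (simp add: algebra_simps)
      ultimately have "\<bar>real (?h (a + Suc i * d)) - real (?h (a + i * d) + e)\<bar> < 1" unfolding of_nat_add by linarith
      then show ?thesis by linarith
    qed
    have "?h (a + i * d) = ?h a + i * e" if "i < k + 2" for i
      using that by (induction i) (simp_all add: step del: mult_Suc, simp)
    moreover have "?h (a + i * d) \<in> D" if "i < k + 2" for i using D(1) ad(3)[OF that] by auto
    ultimately have "\<forall>i<k. ?h a + i * e \<in> D" by (metis trans_less_add1)
    moreover have "0 < ?h a" using C01 C(2) by (auto simp: bohr_def)
    ultimately show ?thesis using e by auto
  qed
  then show ?thesis using D by (auto simp: fam_AP_def)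
qed

text \<open>Piecewise syndetic means bounded gaps on arbitrarily long intervals, and rounding a multiple by
  \<open>\<beta>\<close> scales both the gaps and the intervals, up to a bounded error.\<close>

lemma fam_PS_image:
  assumes C: "C \<in> fam_PS" and "0 < \<beta>"
    and D: "g \<beta> (1/2) ` C \<subseteq> D" "D \<subseteq> Npos"
  shows "D \<in> fam_PS"
proof -
  let ?h = "g \<beta> (1/2)"
  have "\<exists>G. finite G \<and> G \<noteq> {} \<and> G \<subseteq> Npos \<and>
      (\<forall>F. finite F \<and> F \<noteq> {} \<and> F \<subseteq> Npos \<longrightarrow>
        (\<exists>x\<in>Npos. (\<lambda>s. s + x) ` F \<subseteq> (\<Union>t\<in>G. shift t C)))"
    using C unfolding fam_PS_def mem_Collect_eq by (rule conjunct2)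
  then obtain G where G: "finite G" "G \<noteq> {}" "G \<subseteq> Npos"
    and PS: "\<And>F. finite F \<and> F \<noteq> {} \<and> F \<subseteq> Npos \<Longrightarrow>
      \<exists>x\<in>Npos. (\<lambda>s. s + x) ` F \<subseteq> (\<Union>t\<in>G. shift t C)"
    by (elim exE conjE) simp
  \<comment> \<open>A bound for the gaps after scaling: the old gap, one rounding up to a multiple of \<open>\<beta>\<close>, and a
    margin for the rounding errors.\<close>
  define b where "b = nat \<lceil>\<beta> * real (Max G) + \<beta> + 3\<rceil>"
  have b: "\<beta> * real (Max G) + \<beta> + 3 \<le> real b" unfolding b_def by linarith
  have "\<exists>x\<in>Npos. (\<lambda>s. s + x) ` F \<subseteq> (\<Union>t\<in>{1..b}. shift t D)"
    if F: "finite F" "F \<noteq> {}" "F \<subseteq> Npos" for F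
  proof -
    \<comment> \<open>The offset \<open>m s\<close> is chosen so that \<open>\<beta> (m s + x)\<close> lies just above the target \<open>s + x'\<close>.\<close>
    define m where "m s = nat \<lceil>(real s + 3) / \<beta>\<rceil>" for s :: nat
    have m: "real s + 3 \<le> \<beta> * real (m s)" "\<beta> * real (m s) \<le> real s + 3 + \<beta>" "0 < m s" for s
    proof -
      have "0 < (real s + 3) / \<beta>" using \<open>0 < \<beta>\<close> by simp
      then have "(real s + 3) / \<beta> \<le> real (m s)" "real (m s) \<le> (real s + 3) / \<beta> + 1" "0 < m s"
        unfolding m_def by linarith+
      then show "real s + 3 \<le> \<beta> * real (m s)" "\<beta> * real (m s) \<le> real s + 3 + \<beta>" "0 < m s"
        using \<open>0 < \<beta>\<close> by (auto simp: field_simps)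
    qed
    have "finite (m ` F) \<and> m ` F \<noteq> {} \<and> m ` F \<subseteq> Npos" using m(3) F by (simp add: image_subset_iff)
    from PS[OF this] obtain x where x: "0 < x" "(\<lambda>s. s + x) ` m ` F \<subseteq> (\<Union>t\<in>G. shift t C)"
      by auto
    define x' where "x' = ?h x + 1"
    have "s + x' \<in> (\<Union>t\<in>{1..b}. shift t D)" if "s \<in> F" for s
    proof -
      from x(2) that obtain t where t: "t \<in> G" "t + (m s + x) \<in> C" by (auto simp: shift_def)
      let ?n = "t + (m s + x)"
      have hD: "?h ?n \<in> D" using t D(1) by auto
      have err: "\<bar>\<beta> * real ?n - real (?h ?n)\<bar> \<le> 1/2" "\<bar>\<beta> * real x - real (?h x)\<bar> \<le> 1/2"
        by (rule g_half_error[OF less_imp_le[OF \<open>0 < \<beta>\<close>]])+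
      have split: "\<beta> * real ?n = \<beta> * real t + \<beta> * real (m s) + \<beta> * real x" by (simp add: algebra_simps)
      have "t \<le> Max G" using G t by simp
      then have tb: "0 \<le> \<beta> * real t" "\<beta> * real t \<le> \<beta> * real (Max G)" using \<open>0 < \<beta>\<close> by auto
      have "real (s + x' + 1) \<le> real (?h ?n)"
        using err split tb m[of s] unfolding x'_def of_nat_add of_nat_1 by linarith
      moreover have "real (?h ?n) \<le> real (s + x' + b)"
        using err split tb m[of s] b unfolding x'_def of_nat_add of_nat_1 by linarith
      ultimately have "s + x' + 1 \<le> ?h ?n" "?h ?n \<le> s + x' + b" by (simp_all only: of_nat_le_iff)
      then have "?h ?n - (s + x') \<in> {1..b}" "s + x' \<in> shift (?h ?n - (s + x')) D"
        using hD by (auto simp: shift_def x'_def)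
      then show ?thesis by blast
    qed
    then show ?thesis by (intro bexI[of _ x']) (auto simp: x'_def)
  qed
  moreover have "1 \<le> b"
  proof -
    have "0 \<le> \<beta> * real (Max G)" using \<open>0 < \<beta>\<close> by simp
    then have "1 \<le> real b" using b \<open>0 < \<beta>\<close> by linarith
    then show ?thesis by simp
  qed
  ultimately show ?thesis
    unfolding fam_PS_def using D by (intro CollectI conjI exI[of _ "{1..b}"]) auto
qed

text \<open>Rounding is at most linear, so reciprocals shrink by at most a constant factor, and injectivity
  allows the sum to be reindexed.\<close>

lemma fam_HSD_image:
  assumes C: "C \<in> fam_HSD" and inj: "inj_on (g \<beta> (1/2)) C" and "0 \<le> \<beta>"
    and D: "g \<beta> (1/2) ` C \<subseteq> D" "D \<subseteq> Npos"
  shows "D \<in> fam_HSD"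
proof -
  let ?h = "g \<beta> (1/2)"
  obtain K where K: "\<beta> + 1 \<le> real K" using real_arch_simple by blast
  have "\<not> (\<lambda>n. 1 / real n) summable_on D"
  proof
    assume "(\<lambda>n. 1 / real n) summable_on D"
    then have "(\<lambda>n. 1 / real n) summable_on ?h ` C" by (rule summable_on_subset_banach) (rule D)
    then have "(\<lambda>n. 1 / real (?h n)) summable_on C"
      by (simp only: summable_on_reindex[OF inj] o_def)
    then have "(\<lambda>n. real K * (1 / real (?h n))) summable_on C" by (rule summable_on_cmult_right)
    then have "(\<lambda>n. 1 / real n) summable_on C"
    proof (rule summable_on_comparison_test)
      fix n assume n: "n \<in> C"
      have "0 < n" using C n by (auto simp: fam_HSD_def)
      moreover have "0 < ?h n" using D n by auto
      moreover have "real (?h n) \<le> real K * real n"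
        using g_half_le_mult[OF \<open>0 \<le> \<beta>\<close> K \<open>0 < n\<close>] by (metis of_nat_le_iff of_nat_mult)
      ultimately show "1 / real n \<le> real K * (1 / real (?h n))" by (simp add: field_simps)
    qed auto
    then show False using C by (simp add: fam_HSD_def)
  qed
  then show ?thesis using D by (simp add: fam_HSD_def)
qed

text \<open>Reduces both upper densities to a lower bound attained infinitely often.\<close>

lemma Limsup_pos_iff:
  fixes f :: "'a \<Rightarrow> real"
  shows "0 < Limsup F (\<lambda>x. ereal (f x)) \<longleftrightarrow> (\<exists>c>0. \<exists>\<^sub>F x in F. c < f x)"
proof
  assume "0 < Limsup F (\<lambda>x. ereal (f x))"
  then obtain c where c: "0 < ereal c" "ereal c < Limsup F (\<lambda>x. ereal (f x))"
    using ereal_dense2 by blast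
  have "\<exists>\<^sub>F x in F. c < f x"
  proof (rule ccontr)
    assume "\<not> (\<exists>\<^sub>F x in F. c < f x)"
    then have "\<forall>\<^sub>F x in F. ereal (f x) \<le> ereal c" by (simp add: not_frequently not_less)
    from Limsup_bounded[OF this] c show False by simp
  qed
  then show "\<exists>c>0. \<exists>\<^sub>F x in F. c < f x" using c by auto
next
  assume "\<exists>c>0. \<exists>\<^sub>F x in F. c < f x"
  then obtain c where c: "0 < c" "\<exists>\<^sub>F x in F. c < f x" by blast
  have "ereal c \<le> Limsup F (\<lambda>x. ereal (f x))"
    unfolding Limsup_def
  proof (rule INF_greatest)
    fix P assume "P \<in> {P. eventually P F}"
    then have "\<exists>\<^sub>F x in F. c < f x \<and> P x"
      using c(2) by (auto intro: frequently_eventually_frequently)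
    then obtain x where "c < f x" "P x" by (auto dest: frequently_ex)
    then show "ereal c \<le> (SUP x\<in>Collect P. ereal (f x))" by (intro SUP_upper2[of x]) auto
  qed
  then show "0 < Limsup F (\<lambda>x. ereal (f x))" using c(1) by (metis ereal_less(2) less_le_trans)
qed

lemma fam_PUAD_iff:
  "A \<in> fam_PUAD \<longleftrightarrow> A \<subseteq> Npos \<and> (\<exists>c>0. \<forall>N. \<exists>n\<ge>N. c < real (card (A \<inter> {1..n})) / real n)"
  unfolding fam_PUAD_def upper_density_def Limsup_pos_iff frequently_sequentially by auto

lemma fam_PUBD_iff:
  "A \<in> fam_PUBD \<longleftrightarrow> A \<subseteq> Npos \<and>
    (\<exists>c>0. \<forall>N. \<exists>m n. N \<le> n - m \<and> c < real (card (A \<inter> {m + 1..n})) / real (n - m))"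
proof -
  have "0 < upper_banach_density A \<longleftrightarrow> (\<exists>c>0. \<exists>\<^sub>F x in filtercomap (\<lambda>(m, n). n - m) at_top.
      c < (case x of (m, n) \<Rightarrow> real (card (A \<inter> {m + 1..n})) / real (n - m)))"
    unfolding upper_banach_density_def
    by (subst Limsup_pos_iff[symmetric]) (simp add: case_prod_unfold)
  then show ?thesis
    unfolding fam_PUBD_def
    by (simp add: frequently_def eventually_filtercomap_at_top_linorder case_prod_unfold)
qed

text \<open>An initial segment \<open>{1..n}\<close> is mapped into \<open>{1..K n}\<close> injectively on the set, which costs a factor
  of at most \<open>K\<close> in density.\<close>

lemma fam_PUAD_image:
  assumes C: "C \<in> fam_PUAD" and inj: "inj_on (g \<beta> (1/2)) C" and "0 \<le> \<beta>"
    and D: "g \<beta> (1/2) ` C \<subseteq> D" "D \<subseteq> Npos"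
  shows "D \<in> fam_PUAD"
proof -
  let ?h = "g \<beta> (1/2)"
  obtain K where K: "\<beta> + 1 \<le> real K" using real_arch_simple by blast
  then have K0: "0 < K" using \<open>0 \<le> \<beta>\<close> by (cases K) auto
  obtain c where c: "0 < c" and dens: "\<And>N. \<exists>n\<ge>N. c < real (card (C \<inter> {1..n})) / real n"
    using C unfolding fam_PUAD_iff by blast
  have "\<exists>n\<ge>N. c / real K < real (card (D \<inter> {1..n})) / real n" for N
  proof -
    obtain n where n: "N \<le> n" "c < real (card (C \<inter> {1..n})) / real n" using dens by blast
    then have "n \<noteq> 0" using c by (cases n) auto
    have "?h ` (C \<inter> {1..n}) \<subseteq> D \<inter> {1..K * n}"
    proof
      fix y assume "y \<in> ?h ` (C \<inter> {1..n})"
      then obtain x where x: "x \<in> C" "1 \<le> x" "x \<le> n" "y = ?h x" by auto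
      then have "y \<le> K * x" using g_half_le_mult[OF \<open>0 \<le> \<beta>\<close> K, of x] by auto
      also have "\<dots> \<le> K * n" using x by simp
      finally show "y \<in> D \<inter> {1..K * n}" using x D by force
    qed
    then have "card (C \<inter> {1..n}) \<le> card (D \<inter> {1..K * n})"
      by (intro card_inj_on_le[OF inj_on_subset[OF inj]]) auto
    then have "real (card (C \<inter> {1..n})) / real n / real K \<le> real (card (D \<inter> {1..K * n})) / real (K * n)"
      using K0 \<open>n \<noteq> 0\<close> by (simp add: field_simps)
    moreover have "c / real K < real (card (C \<inter> {1..n})) / real n / real K"
      using n(2) K0 by (intro divide_strict_right_mono) auto
    moreover have "N \<le> K * n" using n(1) K0 by (metis le_trans mult_le_mono1 nat_mult_1 Suc_leI One_nat_def)
    ultimately show ?thesis by (intro exI[of _ "K * n"]) auto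
  qed
  then show ?thesis unfolding fam_PUAD_iff using D c K0 by (intro conjI exI[of _ "c / real K"]) auto
qed

text \<open>As for the upper density, but for windows: a window of length \<open>L\<close> is mapped into one of length
  \<open>K L\<close>. The constant 2 in the choice of \<open>K\<close> covers the rounding errors at both ends.\<close>

lemma fam_PUBD_image:
  assumes C: "C \<in> fam_PUBD" and inj: "inj_on (g \<beta> (1/2)) C" and "0 \<le> \<beta>"
    and D: "g \<beta> (1/2) ` C \<subseteq> D" "D \<subseteq> Npos"
  shows "D \<in> fam_PUBD"
proof -
  let ?h = "g \<beta> (1/2)"
  obtain K where K: "\<beta> + 2 \<le> real K" using real_arch_simple by blast
  then have K0: "0 < K" using \<open>0 \<le> \<beta>\<close> by (cases K) auto
  obtain c where c: "0 < c"
    and dens: "\<And>N. \<exists>m n. N \<le> n - m \<and> c < real (card (C \<inter> {m + 1..n})) / real (n - m)"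
    using C unfolding fam_PUBD_iff by blast
  have "\<exists>m n. N \<le> n - m \<and> c / real K < real (card (D \<inter> {m + 1..n})) / real (n - m)" for N
  proof -
    obtain m n where n: "N \<le> n - m" "c < real (card (C \<inter> {m + 1..n})) / real (n - m)" using dens by blast
    then have "m < n" using c by (cases "n - m") auto
    \<comment> \<open>If \<open>h (m + 1) = 0\<close>, the truncated value \<open>M = 0\<close> still works, as elements of \<open>D\<close> are positive.\<close>
    define M where "M = ?h (m + 1) - 1"
    let ?L = "K * (n - m)"
    have top: "?h n \<le> M + ?L"
    proof -
      have "real (?h n) \<le> \<beta> * real n + 1/2" "\<beta> * real (m + 1) - 1/2 \<le> real (?h (m + 1))"
        using g_half_error[OF \<open>0 \<le> \<beta>\<close>, of n] g_half_error[OF \<open>0 \<le> \<beta>\<close>, of "m + 1"] by linarith+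
      moreover have "\<beta> * real n - \<beta> * real (m + 1) \<le> \<beta> * real (n - m)"
        using \<open>m < n\<close> \<open>0 \<le> \<beta>\<close> by (simp add: algebra_simps)
      moreover have "(\<beta> + 2) * real (n - m) \<le> real K * real (n - m)" using K by (intro mult_right_mono) auto
      moreover have "1 \<le> real (n - m)" using \<open>m < n\<close> by linarith
      ultimately have "real (?h n) + 1 \<le> real (?h (m + 1)) + real ?L"
        unfolding of_nat_mult distrib_right by linarith
      then have "real (?h n + 1) \<le> real (?h (m + 1) + ?L)" by simp
      then have "?h n + 1 \<le> ?h (m + 1) + ?L" by (simp only: of_nat_le_iff)
      then show ?thesis unfolding M_def by linarith
    qed
    have "?h ` (C \<inter> {m + 1..n}) \<subseteq> D \<inter> {M + 1..M + ?L}"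
    proof
      fix y assume "y \<in> ?h ` (C \<inter> {m + 1..n})"
      then obtain x where x: "x \<in> C" "m + 1 \<le> x" "x \<le> n" "y = ?h x" by auto
      have "?h (m + 1) \<le> ?h x" "?h x \<le> ?h n" using x \<open>0 \<le> \<beta>\<close> by (auto intro!: g_half_mono)
      moreover have "0 < y" "y \<in> D" using D x by auto
      ultimately show "y \<in> D \<inter> {M + 1..M + ?L}" using top x(4) by (auto simp: M_def)
    qed
    then have "card (C \<inter> {m + 1..n}) \<le> card (D \<inter> {M + 1..M + ?L})"
      by (intro card_inj_on_le[OF inj_on_subset[OF inj]]) auto
    then have "real (card (C \<inter> {m + 1..n})) / real (n - m) / real K
        \<le> real (card (D \<inter> {M + 1..M + ?L})) / real ?L"
      using K0 \<open>m < n\<close> by (simp add: divide_right_mono mult.commute)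
    moreover have "c / real K < real (card (C \<inter> {m + 1..n})) / real (n - m) / real K"
      using n(2) K0 by (intro divide_strict_right_mono) auto
    moreover have "N \<le> ?L" using n(1) K0 by (metis le_trans mult_le_mono1 nat_mult_1 Suc_leI One_nat_def)
    ultimately show ?thesis by (intro exI[of _ M] exI[of _ "M + ?L"]) auto
  qed
  then show ?thesis unfolding fam_PUBD_iff using D c K0 by (intro conjI exI[of _ "c / real K"]) auto
qed

section \<open>J-sets\<close>

text \<open>Pigeonhole in a torus: among infinitely many points spaced \<open>L\<close> apart, two lie in the same cell in
  all of the finitely many coordinates.\<close>

lemma simultaneous_recurrence:
  fixes P :: "'f \<Rightarrow> nat \<Rightarrow> real"
  assumes "finite F" "0 < \<delta>" "0 < L"
  shows "\<exists>u v. N \<le> u \<and> u + L \<le> v \<and> (\<forall>f\<in>F. \<exists>k::int. \<bar>P f v - P f u - of_int k\<bar> < \<delta>)"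
proof -
  obtain M where M: "inverse (real (Suc M)) < \<delta>" using reals_Archimedean[OF \<open>0 < \<delta>\<close>] by auto
  let ?c = "\<lambda>x. \<lfloor>real (Suc M) * frac x\<rfloor>"
  have close: "\<exists>k::int. \<bar>x - y - of_int k\<bar> < \<delta>" if "?c x = ?c y" for x y :: real
    using frac_cell_close[OF that] M less_trans by blast
  define \<phi> where "\<phi> j = (\<lambda>f\<in>F. ?c (P f (N + j * L)))" for j
  have "range \<phi> \<subseteq> F \<rightarrow>\<^sub>E {0..int (Suc M)}" using frac_cell_range by (auto simp: \<phi>_def)
  then have "finite (range \<phi>)" by (rule finite_subset) (intro finite_PiE assms finite_atLeastAtMost_int)
  then have "\<not> inj \<phi>" using finite_imageD infinite_UNIV_nat by blast
  then obtain i j where ij: "i < j" "\<phi> i = \<phi> j"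
    unfolding inj_def by (metis nat_neq_iff)
  have "\<exists>k::int. \<bar>P f (N + j * L) - P f (N + i * L) - of_int k\<bar> < \<delta>" if "f \<in> F" for f
    using close fun_cong[OF ij(2), of f] that by (auto simp: \<phi>_def)
  moreover have "N + i * L + L \<le> N + j * L"
    using mult_le_mono1[of "Suc i" j L] ij(1) by simp
  ultimately show ?thesis by (intro exI[of _ "N + i * L"] exI[of _ "N + j * L"]) auto
qed

text \<open>Apply recurrence to the partial sums of \<open>\<alpha> f\<close>, each time starting beyond the preceding block.
  The errors decay geometrically, so that sums over any finite set of blocks stay within \<open>2 \<delta>\<close> of
  integers.\<close>

lemma almost_integral_blocks:
  fixes F :: "(nat \<Rightarrow> nat) set"
  assumes "finite F" "0 < \<delta>" "0 < L" "0 \<le> \<alpha>"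
  obtains u v :: "nat \<Rightarrow> nat" where "\<And>n. u n + L \<le> v n" "\<And>m n. m < n \<Longrightarrow> v m \<le> u n"
    "\<And>n f. f \<in> F \<Longrightarrow> \<bar>\<alpha> * real (\<Sum>t\<in>{u n<..v n}. f t) - real (g \<alpha> (1/2) (\<Sum>t\<in>{u n<..v n}. f t))\<bar> < \<delta> / 2 ^ n"
proof -
  define P where "P f n = \<alpha> * real (\<Sum>t\<in>{0<..n}. f t)" for f :: "nat \<Rightarrow> nat" and n
  have P_diff: "P f v - P f u = \<alpha> * real (\<Sum>t\<in>{u<..v}. f t)" if "u \<le> v" for f u v
  proof -
    have "{0<..v} = {0<..u} \<union> {u<..v}" using that by auto
    then have "(\<Sum>t\<in>{0<..v}. f t) = (\<Sum>t\<in>{0<..u}. f t) + (\<Sum>t\<in>{u<..v}. f t)"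
      by (simp add: sum.union_disjoint ivl_disj_int)
    then show ?thesis by (simp add: P_def algebra_simps)
  qed
  define good where "good n w \<longleftrightarrow> fst w + L \<le> snd w \<and>
    (\<forall>f\<in>F. \<exists>k::int. \<bar>P f (snd w) - P f (fst w) - of_int k\<bar> < \<delta> / 2 ^ n)" for n :: nat and w
  have ex: "\<exists>w. good n w \<and> N \<le> fst w" for n N
    using simultaneous_recurrence[OF assms(1) _ assms(3), of "\<delta> / 2 ^ n" N P] assms(2)
    by (auto simp: good_def)
  then obtain w where w: "\<And>n. good n (w n)" "\<And>n. snd (w n) \<le> fst (w (Suc n))"
    using dependent_nat_choice[of good "\<lambda>n w w'. snd w \<le> fst w'"] by metis
  have len: "fst (w n) + L \<le> snd (w n)" for n using w(1) by (auto simp: good_def)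
  show thesis
  proof (rule that[of "fst \<circ> w" "snd \<circ> w"])
    fix m n :: nat assume "m < n"
    then show "(snd \<circ> w) m \<le> (fst \<circ> w) n"
    proof (induction rule: strict_inc_induct)
      case (base i)
      then show ?case using w(2)[of i] by simp
    next
      case (step i)
      then show ?case using w(2)[of i] len[of "Suc i"] by simp
    qed
  next
    fix n f assume "f \<in> F"
    then obtain k :: int where "\<bar>P f (snd (w n)) - P f (fst (w n)) - of_int k\<bar> < \<delta> / 2 ^ n"
      using w(1) by (auto simp: good_def)
    then show "\<bar>\<alpha> * real (\<Sum>t\<in>{(fst \<circ> w) n<..(snd \<circ> w) n}. f t) -
        real (g \<alpha> (1/2) (\<Sum>t\<in>{(fst \<circ> w) n<..(snd \<circ> w) n}. f t))\<bar> < \<delta> / 2 ^ n"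
      using P_diff[of "fst (w n)" "snd (w n)" f] len[of n]
        g_half_nearest[OF assms(4), of "\<Sum>t\<in>{fst (w n)<..snd (w n)}. f t" k]
      by simp
  qed (use len in simp)
qed

text \<open>Given sequences \<open>f\<close>, let \<open>lift f n\<close> be the integer nearest to \<open>\<alpha>\<close> times the sum of \<open>f\<close> over the
  \<open>n\<close>-th block, with \<open>\<alpha> = 1/\<beta>\<close>. A solution \<open>a + (\<Sum>n\<in>H. lift f n) \<in> C\<close> is rounded by \<open>h\<close> to
  \<open>h a\<close> plus the sum of \<open>f\<close> over the union of the blocks: the accumulated error is at most 1/4, the
  Bohr set contributes less than 1/4, and rounding \<open>a\<close> at most 1/2.

  As \<open>h a\<close> may be 0, the constant sequence 1 is carried along and its lift is added to every
  lift: this contributes a positive integer that is the same for all \<open>f\<close>, and also makes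
  every lift positive.\<close>

lemma fam_J_image:
  assumes C: "C \<in> fam_J" "C \<subseteq> bohr \<beta> (1/4)" and "0 < \<beta>"
    and D: "g \<beta> (1/2) ` C \<subseteq> D" "D \<subseteq> Npos"
  shows "D \<in> fam_J"
proof -
  let ?h = "g \<beta> (1/2)"
  define \<alpha> where "\<alpha> = 1 / \<beta>"
  have \<alpha>: "0 < \<alpha>" "\<beta> * \<alpha> = 1" using \<open>0 < \<beta>\<close> by (auto simp: \<alpha>_def)
  let ?k = "g \<alpha> (1/2)"
  have "\<exists>a\<in>Npos. \<exists>H. finite H \<and> H \<noteq> {} \<and> H \<subseteq> Npos \<and> (\<forall>f\<in>F. a + (\<Sum>n\<in>H. f n) \<in> D)"
    if F: "finite F" "F \<noteq> {}" "F \<subseteq> (Npos \<rightarrow> Npos)" for F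
  proof -
    let ?one = "\<lambda>_::nat. 1::nat"
    \<comment> \<open>Blocks of length at least \<open>\<beta>\<close> have \<open>\<alpha>\<close>-multiples at least 1, hence positive roundings.\<close>
    obtain L where L: "\<beta> \<le> real L" using real_arch_simple by blast
    then have L0: "0 < L" using \<open>0 < \<beta>\<close> by (cases L) auto
    obtain u v where len: "\<And>n. u n + L \<le> v n" and ord: "\<And>m n. m < n \<Longrightarrow> v m \<le> u n"
      and err: "\<And>n f. f \<in> insert ?one F \<Longrightarrow> \<bar>\<alpha> * real (\<Sum>t\<in>{u n<..v n}. f t) - real (?k (\<Sum>t\<in>{u n<..v n}. f t))\<bar> < (\<alpha>/16) / 2 ^ n"
      using almost_integral_blocks[of "insert ?one F" "\<alpha>/16" L \<alpha>] F(1) \<alpha> L0 by (metis finite_insert divide_pos_pos zero_less_numeral less_imp_le)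
    define S where "S f n = (\<Sum>t\<in>{u n<..v n}. f t)" for f :: "nat \<Rightarrow> nat" and n
    define lift where "lift f n = ?k (S ?one n) + ?k (S f n)" for f n
    have lift_pos: "0 < lift f n" for f n
    proof -
      have "real L \<le> real (S ?one n)" using len[of n] by (simp add: S_def)
      then have "\<beta> \<le> real (S ?one n)" using L by linarith
      then have "\<alpha> * \<beta> \<le> \<alpha> * real (S ?one n)" using \<alpha> by (intro mult_left_mono) auto
      then have "1 \<le> \<alpha> * real (S ?one n)" using \<alpha>(2) by (simp only: mult.commute)
      then have "0 < ?k (S ?one n)" by (simp add: g_def)
      then show ?thesis by (simp add: lift_def)
    qed
    then have lifts: "finite (lift ` F) \<and> lift ` F \<noteq> {} \<and> lift ` F \<subseteq> (Npos \<rightarrow> Npos)"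
      using F(1,2) by (simp add: image_subset_iff Pi_iff)
    have "\<exists>a\<in>Npos. \<exists>H. finite H \<and> H \<noteq> {} \<and> H \<subseteq> Npos \<and> (\<forall>f\<in>lift ` F. a + (\<Sum>n\<in>H. f n) \<in> C)"
      by (rule conjunct2[OF C(1)[unfolded fam_J_def mem_Collect_eq], THEN spec, THEN mp, OF lifts])
    then obtain a H where aH: "0 < a" "finite H" "H \<noteq> {}" "H \<subseteq> Npos"
      and inC: "\<And>f. f \<in> F \<Longrightarrow> a + (\<Sum>n\<in>H. lift f n) \<in> C"
      unfolding ball_simps bex_simps by auto
    define H' where "H' = (\<Union>n\<in>H. {u n<..v n})"
    have sum_H': "(\<Sum>t\<in>H'. f t) = (\<Sum>n\<in>H. S f n)" for f :: "nat \<Rightarrow> nat"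
      unfolding H'_def S_def
    proof (rule sum.UNION_disjoint)
      show "\<forall>i\<in>H. \<forall>j\<in>H. i \<noteq> j \<longrightarrow> {u i<..v i} \<inter> {u j<..v j} = {}"
      proof (intro ballI impI)
        fix i j :: nat assume "i \<noteq> j"
        then show "{u i<..v i} \<inter> {u j<..v j} = {}"
          using ord[of i j] ord[of j i] by (cases "i < j") auto
      qed
    qed (use aH in auto)
    have H': "finite H'" "H' \<noteq> {}" "H' \<subseteq> Npos"
    proof -
      obtain n where "n \<in> H" using aH by auto
      moreover have "v n \<in> {u n<..v n}" using len[of n] L0 by auto
      ultimately show "H' \<noteq> {}" unfolding H'_def by blast
    qed (use aH in \<open>auto simp: H'_def\<close>)
    define T where "T f = (\<Sum>t\<in>H'. f t)" for f :: "nat \<Rightarrow> nat"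
    have key: "?h a + T ?one + T f \<in> D" if f: "f \<in> F" for f
    proof -
      let ?c = "a + (\<Sum>n\<in>H. lift f n)"
      have "\<bar>\<alpha> * real (T ?one + T f) - real (\<Sum>n\<in>H. lift f n)\<bar>
          = \<bar>\<Sum>n\<in>H. \<alpha> * real (S ?one n) + \<alpha> * real (S f n) - real (lift f n)\<bar>"
        by (simp only: T_def sum_H' of_nat_sum of_nat_add distrib_left sum_distrib_left sum.distrib sum_subtractf)
      also have "\<dots> \<le> (\<Sum>n\<in>H. \<bar>\<alpha> * real (S ?one n) + \<alpha> * real (S f n) - real (lift f n)\<bar>)"
        by (rule sum_abs)
      also have "\<dots> \<le> (\<Sum>n\<in>H. (\<alpha>/8) * (1/2) ^ n)"
      proof (rule sum_mono)
        fix n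
        show "\<bar>\<alpha> * real (S ?one n) + \<alpha> * real (S f n) - real (lift f n)\<bar> \<le> (\<alpha>/8) * (1/2) ^ n"
          using err[of ?one n] err[of f n] f unfolding S_def[symmetric] lift_def
          by (simp add: power_divide) 
      qed
      also have "\<dots> = (\<alpha>/8) * (\<Sum>n\<in>H. (1/2) ^ n)" by (simp add: sum_distrib_left)
      also have "\<dots> \<le> (\<alpha>/8) * 2"
      proof (rule mult_left_mono)
        have "(\<Sum>n\<in>H. (1/2::real) ^ n) \<le> (\<Sum>n. (1/2) ^ n)"
          using aH(2) by (intro sum_le_suminf) (auto intro: summable_geometric)
        then show "(\<Sum>n\<in>H. (1/2::real) ^ n) \<le> 2" by (simp add: suminf_geometric)
      qed (use \<alpha> in auto)
      finally have "\<bar>\<alpha> * real (T ?one + T f) - real (\<Sum>n\<in>H. lift f n)\<bar> \<le> \<alpha>/4" by simp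
      then have "\<beta> * \<bar>\<alpha> * real (T ?one + T f) - real (\<Sum>n\<in>H. lift f n)\<bar> \<le> \<beta> * (\<alpha>/4)"
        using \<open>0 < \<beta>\<close> by (intro mult_left_mono) auto
      moreover have "\<beta> * \<bar>\<alpha> * real (T ?one + T f) - real (\<Sum>n\<in>H. lift f n)\<bar>
          = \<bar>\<beta> * (\<alpha> * real (T ?one + T f) - real (\<Sum>n\<in>H. lift f n))\<bar>"
        using \<open>0 < \<beta>\<close> by (simp only: abs_mult abs_of_pos)
      moreover have "\<beta> * (\<alpha> * real (T ?one + T f) - real (\<Sum>n\<in>H. lift f n))
          = real (T ?one + T f) - \<beta> * real (\<Sum>n\<in>H. lift f n)"
        using \<alpha>(2) by (simp only: right_diff_distrib mult.assoc[symmetric] mult_1_left)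
      moreover have "\<beta> * (\<alpha>/4) = 1/4" using \<alpha>(2) by simp
      ultimately have "\<bar>real (T ?one + T f) - \<beta> * real (\<Sum>n\<in>H. lift f n)\<bar> \<le> 1/4" by simp
      moreover have "\<bar>\<beta> * real ?c - real (?h ?c)\<bar> < 1/4" using C(2) inC[OF f] by (auto simp: bohr_def)
      moreover have "\<bar>\<beta> * real a - real (?h a)\<bar> \<le> 1/2" by (rule g_half_error[OF less_imp_le[OF \<open>0 < \<beta>\<close>]])
      moreover have "\<beta> * real ?c = \<beta> * real a + \<beta> * real (\<Sum>n\<in>H. lift f n)"
        by (simp only: of_nat_add distrib_left)
      ultimately have "\<bar>real (?h ?c) - real (?h a + T ?one + T f)\<bar> < 1"
        unfolding of_nat_add by linarith
      then have "?h ?c = ?h a + T ?one + T f" by linarith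
      moreover have "?h ?c \<in> D" using D(1) inC[OF f] by blast
      ultimately show ?thesis by simp
    qed
    have "0 < T ?one" using H' by (simp add: T_def card_gt_0_iff)
    then show ?thesis
      using H' key by (intro bexI[of _ "?h a + T ?one"] exI[of _ H']) (auto simp: T_def)
  qed
  then show ?thesis using D unfolding fam_J_def by auto
qed

section \<open>Images of essential star sets\<close>

text \<open>Otherwise the complement of \<open>A\<close> would be an essential set disjoint from \<open>A\<close>.\<close>

lemma essential_star_mem_idempotent:
  assumes "essential_star \<F> A" "p \<in> beta \<F>" "uf_plus p p = p"
  shows "A \<in> p"
proof (rule ccontr)
  assume "A \<notin> p"
  then have "Npos - A \<in> p"
    using assms uf_compl[of p A] by (auto simp: beta_def essential_star_def)
  then have "essential \<F> (Npos - A)" using assms by (auto simp: essential_def)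
  then show False using assms(1) by (auto simp: essential_star_def)
qed

text \<open>The common part for all families: any family preserved by rounding on Bohr sets will do.\<close>

lemma essential_star_g_image:
  assumes "0 < \<alpha>" "0 < \<gamma>" "\<gamma> < 1" and star: "essential_star \<F> A"
    and preserved: "\<And>C D. C \<in> \<F> \<Longrightarrow> C \<subseteq> bohr (1/\<alpha>) (1/4) \<Longrightarrow> inj_on (g (1/\<alpha>) (1/2)) C \<Longrightarrow>
      g (1/\<alpha>) (1/2) ` C \<subseteq> D \<Longrightarrow> D \<subseteq> Npos \<Longrightarrow> D \<in> \<F>"
  shows "essential_star \<F> (g_image \<alpha> \<gamma> A)"
  unfolding essential_star_def
proof (intro conjI allI impI)
  show "g_image \<alpha> \<gamma> A \<subseteq> Npos" by (auto simp: g_image_def)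
next
  fix B assume "essential \<F> B"
  then obtain q where q: "q \<in> ultrafilters_N" "q \<subseteq> \<F>" "uf_plus q q = q" "B \<in> q"
    by (auto simp: essential_def beta_def)
  let ?h = "g (1/\<alpha>) (1/2)"
  \<comment> \<open>The bound 1/4 gives additivity of \<open>h\<close>; the other bound gives \<open>g \<alpha> \<gamma> (h n) = n\<close>.\<close>
  define \<epsilon> where "\<epsilon> = min (1/4) (min \<gamma> (1 - \<gamma>) / \<alpha>)"
  define E where "E = bohr (1/\<alpha>) \<epsilon>"
  have \<epsilon>: "0 < \<epsilon>" using assms(1-3) by (simp add: \<epsilon>_def)
  have \<epsilon>4: "\<epsilon> \<le> 1/4" unfolding \<epsilon>_def by (rule min.cobounded1)
  have "\<epsilon> \<le> min \<gamma> (1 - \<gamma>) / \<alpha>" by (simp add: \<epsilon>_def)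
  then have "\<alpha> * \<epsilon> \<le> min \<gamma> (1 - \<gamma>)" using assms(1) by (simp add: field_simps)
  then have inv: "g \<alpha> \<gamma> (?h n) = n" if "n \<in> E" for n
    using g_inverse_on_bohr[OF assms(1) _ _ that[unfolded E_def], of \<gamma>] by simp
  have Eq: "E \<in> q" unfolding E_def by (rule idempotent_bohr) (use q \<epsilon> assms in auto)
  have E4: "E \<subseteq> bohr (1/\<alpha>) (1/4)" unfolding E_def by (rule bohr_mono[OF \<epsilon>4])
  have E_pos: "0 < ?h n" if "n \<in> E" for n using that by (simp add: E_def bohr_def)
  let ?p = "uf_image ?h q"
  have p_uf: "?p \<in> ultrafilters_N" using uf_image_ultrafilter[OF q(1) Eq] E_pos by blast
  have p_idem: "uf_plus ?p ?p = ?p"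
  proof (rule uf_image_idempotent[OF q(1,3) Eq E_pos])
    fix x y assume "x \<in> E" "y \<in> E"
    then show "?h (x + y) = ?h x + ?h y" using E4 assms(1) by (intro g_half_add) auto
  qed
  have "D \<in> \<F>" if "D \<in> ?p" for D
  proof -
    have "{n \<in> Npos. ?h n \<in> D} \<inter> E \<in> q"
      using that uf_inter[OF q(1) _ Eq] by (simp add: uf_image_def)
    then have "{n \<in> Npos. ?h n \<in> D} \<inter> E \<in> \<F>" using q(2) by blast
    then show ?thesis
    proof (rule preserved)
      show "inj_on ?h ({n \<in> Npos. ?h n \<in> D} \<inter> E)"
        by (rule inj_on_inverseI[of _ "g \<alpha> \<gamma>"]) (use inv in auto)
    qed (use that E4 in \<open>auto simp: uf_image_def\<close>)
  qed
  then have "?p \<in> beta \<F>" using p_uf by (auto simp: beta_def)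
  then have "A \<in> ?p" using essential_star_mem_idempotent[OF star] p_idem by blast
  then have "{n \<in> Npos. ?h n \<in> A} \<inter> (B \<inter> E) \<in> q"
    using uf_inter[OF q(1) _ uf_inter[OF q(1,4) Eq]] by (simp add: uf_image_def)
  from uf_nonempty[OF q(1) this]
  obtain n where n: "0 < n" "?h n \<in> A" "n \<in> B" "n \<in> E" by auto
  then have "n \<in> g_image \<alpha> \<gamma> A"
    unfolding g_image_def using inv[OF n(4)] by (auto intro!: image_eqI[of n _ "?h n"])
  then show "g_image \<alpha> \<gamma> A \<inter> B \<noteq> {}" using n by blast
qed

theorem corollary3p8:
  fixes \<alpha> \<gamma> :: real and \<F> :: "nat set set" and A :: "nat set"
  assumes "\<alpha> > 0" and "0 < \<gamma>" and "\<gamma> < 1"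
    and "\<F> \<in> {fam_IF, fam_AP, fam_PS, fam_HSD, fam_J, fam_PUAD, fam_PUBD}"
    and "essential_star \<F> A"
  shows "essential_star \<F> (g_image \<alpha> \<gamma> A)"
proof (rule essential_star_g_image[OF assms(1-3,5)])
  fix C D
  let ?h = "g (1/\<alpha>) (1/2)"
  assume C: "C \<in> \<F>" "C \<subseteq> bohr (1/\<alpha>) (1/4)" "inj_on ?h C" and D: "?h ` C \<subseteq> D" "D \<subseteq> Npos"
  have \<beta>: "0 < 1 / \<alpha>" "0 \<le> 1 / \<alpha>" using assms(1) by auto
  from assms(4) consider "\<F> = fam_IF" | "\<F> = fam_AP" | "\<F> = fam_PS" | "\<F> = fam_HSD"
    | "\<F> = fam_J" | "\<F> = fam_PUAD" | "\<F> = fam_PUBD"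
    by auto
  then show "D \<in> \<F>"
  proof cases
    case 1
    with C(1) show ?thesis using fam_IF_image[OF _ C(3) D] by simp
  next
    case 2
    with C(1) show ?thesis using fam_AP_image[OF _ C(2,3) \<beta>(2) D] by simp
  next
    case 3
    with C(1) show ?thesis using fam_PS_image[OF _ \<beta>(1) D] by simp
  next
    case 4
    with C(1) show ?thesis using fam_HSD_image[OF _ C(3) \<beta>(2) D] by simp
  next
    case 5
    with C(1) show ?thesis using fam_J_image[OF _ C(2) \<beta>(1) D] by simp
  next
    case 6
    with C(1) show ?thesis using fam_PUAD_image[OF _ C(3) \<beta>(2) D] by simp
  next
    case 7
    with C(1) show ?thesis using fam_PUBD_image[OF _ C(3) \<beta>(2) D] by simp
  qed
qed

end
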